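(* Let $G$ be a complete multipartite graph with at least two parts, regarded as a graph of goods, and let $N=[n]$ be any finite set of $n\ge1$ agents with nonnegative additive utility functions $u_1,\dots,u_n$ on $V(G)$. Then there exists a $\frac14$-mms-allocation, i.e., a $(G,n)$-partition $(A_1,\dots,A_n)$ of $V(G)$ into bundles such that $u_i(A_i)\ge \frac14\,\mathsf{mms}^{(n)}(G,u_i)$ for every $i\in[n]$.
   Context: A graph is complete multipartite if its vertex set can be partitioned into (nonempty) parts such that two vertices are adjacent if and only if they lie in different parts. Goods are the vertices of $G$. Each agent $i$ has a utility function $u_i$ assigning a nonnegative real to each vertex, extended additively to sets: $u_i(X)=\sum_{v\in X}u_i(v)$, $u_i(\emptyset)=0$. A bundle is a set $X\subseteq V(G)$ inducing a connected subgraph of $G$ (the empty set is a bundle). A $(G,n)$-partition is a tuple $(P_1,\dots,P_n)$ of pairwise disjoint bundles with $\bigcup_j P_j=V(G)$; as an allocation, $P_i$ is given to agent $i$. The maximin share is $\mathsf{mms}^{(n)}(G,u)=\max_{(P_1,\dots,P_n)}\min_{j\in[n]}u(P_j)$, the maximum over all $(G,n)$-partitions. *)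

theory Defs
  imports Complex_Main "HOL-Library.Disjoint_Sets" "Graph_Theory.Digraph_Component"
begin

text \<open>
  The predicate \<^const>\<open>graph\<close> describes finite simple graphs, represented as symmetric digraphs
  without loops and without parallel arcs.
\<close>

definition complete_multipartite :: "('a, 'b) pre_digraph \<Rightarrow> 'a set set \<Rightarrow> bool" where
  "complete_multipartite G Q \<longleftrightarrow>
     graph G \<and> partition_on (verts G) Q \<and>
     (\<forall>u\<in>verts G. \<forall>v\<in>verts G. u \<rightarrow>\<^bsub>G\<^esub> v \<longleftrightarrow> \<not> (\<exists>W\<in>Q. u \<in> W \<and> v \<in> W))"

text \<open>
  The library's connected graphs are nonempty, so the empty bundle is admitted separately.
\<close>

definition is_bundle :: "('a, 'b) pre_digraph \<Rightarrow> 'a set \<Rightarrow> bool" where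
  "is_bundle G X \<longleftrightarrow> X \<subseteq> verts G \<and> (X = {} \<or> Digraph_Component.connected (G \<restriction> X))"

text \<open>
  An \<open>n\<close>-tuple of bundles is a function on \<^typ>\<open>nat\<close> of which only the values at
  \<open>1, \<dots>, n\<close> matter.
\<close>

definition graph_partition :: "('a, 'b) pre_digraph \<Rightarrow> nat \<Rightarrow> (nat \<Rightarrow> 'a set) \<Rightarrow> bool" where
  "graph_partition G n P \<longleftrightarrow>
     (\<forall>j\<in>{1..n}. is_bundle G (P j)) \<and> disjoint_family_on P {1..n} \<and> (\<Union>j\<in>{1..n}. P j) = verts G"

definition utility :: "('a \<Rightarrow> real) \<Rightarrow> 'a set \<Rightarrow> real" where
  "utility u X = (\<Sum>v\<in>X. u v)"

definition mms :: "nat \<Rightarrow> ('a, 'b) pre_digraph \<Rightarrow> ('a \<Rightarrow> real) \<Rightarrow> real" where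
  "mms n G u = Max {Min ((\<lambda>j. utility u (P j)) ` {1..n}) | P. graph_partition G n P}"

definition mms_allocation ::
  "real \<Rightarrow> ('a, 'b) pre_digraph \<Rightarrow> nat \<Rightarrow> (nat \<Rightarrow> 'a \<Rightarrow> real) \<Rightarrow> (nat \<Rightarrow> 'a set) \<Rightarrow> bool" where
  "mms_allocation \<alpha> G n u A \<longleftrightarrow>
     graph_partition G n A \<and> (\<forall>i\<in>{1..n}. utility (u i) (A i) \<ge> \<alpha> * mms n G (u i))"

text \<open>
  The maximum in \<^const>\<open>mms\<close> ranges over a finite set, which is nonempty for connected \<open>G\<close>
  and \<open>n \<ge> 1\<close>; so it is a genuine maximum.
\<close>

lemma finite_mms_values:
  assumes "finite (verts G)" "n \<ge> 1"
  shows "finite {Min ((\<lambda>j. utility u (P j)) ` {1..n}) | P. graph_partition G n P}"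
proof (rule finite_subset)
  show "{Min ((\<lambda>j. utility u (P j)) ` {1..n}) | P. graph_partition G n P}
          \<subseteq> utility u ` Pow (verts G)"
  proof
    fix x assume "x \<in> {Min ((\<lambda>j. utility u (P j)) ` {1..n}) | P. graph_partition G n P}"
    then obtain P where x: "x = Min ((\<lambda>j. utility u (P j)) ` {1..n})" and P: "graph_partition G n P"
      by blast
    have "x \<in> (\<lambda>j. utility u (P j)) ` {1..n}"
      unfolding x using assms(2) by (intro Min_in) auto
    then show "x \<in> utility u ` Pow (verts G)"
      using P by (auto simp: graph_partition_def is_bundle_def)
  qed
qed (use assms in simp)

lemma graph_partition_exists:
  assumes "wf_digraph G" "Digraph_Component.connected G" "n \<ge> 1"
  shows "graph_partition G n (\<lambda>j. if j = 1 then verts G else {})"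
proof -
  interpret wf_digraph G by fact
  have "G \<restriction> verts G = G" by (intro pre_digraph.equality) auto
  then show ?thesis
    using assms by (auto simp: graph_partition_def is_bundle_def disjoint_family_on_def)
qed

lemma complete_multipartite_connected:
  assumes "complete_multipartite G Q" "card Q \<ge> 2"
  shows "Digraph_Component.connected G"
proof -
  interpret graph G using assms by (simp add: complete_multipartite_def)
  have part: "partition_on (verts G) Q"
    and adj: "\<And>u v. u \<in> verts G \<Longrightarrow> v \<in> verts G \<Longrightarrow>
      u \<rightarrow>\<^bsub>G\<^esub> v \<longleftrightarrow> \<not> (\<exists>W\<in>Q. u \<in> W \<and> v \<in> W)"
    using assms(1) by (auto simp: complete_multipartite_def)
  have uniq: "W = W'" if "W \<in> Q" "W' \<in> Q" "x \<in> W" "x \<in> W'" for W W' x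
    using part that by (auto simp: partition_on_def disjoint_def)
  have reach: "u \<rightarrow>\<^sup>*\<^bsub>G\<^esub> v" if uv: "u \<in> verts G" "v \<in> verts G" for u v
  proof (cases "u \<rightarrow>\<^bsub>G\<^esub> v")
    case True
    then show ?thesis by (rule reachable_adjI)
  next
    case False
    then obtain W where W: "W \<in> Q" "u \<in> W" "v \<in> W" using adj uv by blast
    have "\<not> Q \<subseteq> {W}" using assms(2) card_mono[of "{W}" Q] by auto
    then obtain W' where W': "W' \<in> Q" "W' \<noteq> W" by blast
    obtain w where w: "w \<in> W'" using part W' by (metis partition_on_def ex_in_conv)
    have "w \<in> verts G" using part W' w by (auto simp: partition_on_def)
    then have "u \<rightarrow>\<^bsub>G\<^esub> w" "w \<rightarrow>\<^bsub>G\<^esub> v"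
      using adj uv W W' w uniq by metis+
    then show ?thesis by (meson reachable_adjI reachable_trans)
  qed
  have "Q \<noteq> {}" using assms(2) by auto
  then have "verts G \<noteq> {}" using part by (auto simp: partition_on_def)
  then show ?thesis
    using reach reachable_mk_symmetricI
    by (auto simp: connected_def strongly_connected_def mk_symmetric_def)
qed

end

theory Submission
  imports Defs
begin

text \<open>
  Colour the vertices by their parts: a vertex set is a bundle iff it has at most one element or
  meets two colours, and any leftover vertices can be attached to one of the bundles, so disjoint
  bundles suffice. Normalise all positive maximin shares to \<open>1\<close>. A vertex worth at least
  \<open>1/4\<close> to some agent is given to that agent; the others lose at most one of their bundles.
  If no such vertex exists, every share has two colours and every agent values the whole graph at
  \<open>n\<close> or more. Take a maximum matching \<open>M\<close> and let \<open>U\<close> be the set of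
  unmatched vertices. Fill each bag with one edge of \<open>M\<close>, then vertices of \<open>U\<close>,
  then further edges, until it is worth \<open>1/4\<close> to some agent. The last addition is worth at
  most \<open>1/2\<close>, so a bag costs the others at most \<open>3/4\<close>. Edges do not run out:
  either \<open>U\<close> has at most one vertex, or the matching covers every colour but one and then has
  at least \<open>n\<close> edges, as every share contains a vertex of another colour.
\<close>

section \<open>Coloured sets and bag filling\<close>

definition bichromatic :: "('a \<Rightarrow> 'c) \<Rightarrow> 'a set \<Rightarrow> bool" where
  "bichromatic f X \<longleftrightarrow> (\<exists>x\<in>X. \<exists>y\<in>X. f x \<noteq> f y)"

lemma bichromatic_mono: "bichromatic f X \<Longrightarrow> X \<subseteq> Y \<Longrightarrow> bichromatic f Y"
  unfolding bichromatic_def by blast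

lemma bichromatic_obtains:
  assumes "bichromatic f X"
  obtains z where "z \<in> X" "f z \<noteq> c"
  using assms unfolding bichromatic_def by metis

text \<open>Induction on the number of agents. A bag costs each remaining agent at most 3/4, so the
  total stays at least the number of agents. The last hypothesis guarantees an edge for every bag: a
  bag either uses a single edge, lowering \<open>card M\<close> in step with \<open>card S\<close>,
  or swallows all of \<open>U\<close>.\<close>

lemma bag_filling:
  fixes u :: "'i \<Rightarrow> 'a \<Rightarrow> real"
  assumes "finite S" "finite M" "disjoint M" "finite U" "U \<inter> \<Union>M = {}"
    and "\<And>e. e \<in> M \<Longrightarrow> finite e \<and> bichromatic f e"
    and "\<And>i e. i \<in> S \<Longrightarrow> e \<in> M \<Longrightarrow> sum (u i) e \<le> 1/2"
    and "\<And>i x. i \<in> S \<Longrightarrow> x \<in> U \<Longrightarrow> u i x \<le> 1/4"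
    and "\<And>i. i \<in> S \<Longrightarrow> real (card S) \<le> sum (u i) (U \<union> \<Union>M)"
    and "card U \<le> 1 \<or> card S \<le> card M"
  shows "\<exists>A. disjoint_family_on A S \<and>
    (\<forall>i\<in>S. A i \<subseteq> U \<union> \<Union>M \<and> bichromatic f (A i) \<and> 1/4 \<le> sum (u i) (A i))"
  using assms
proof (induction "card S" arbitrary: S M U)
  case 0
  then show ?case by (auto simp: disjoint_family_on_def)
next
  case (Suc k)
  note finS = \<open>finite S\<close> and finM = \<open>finite M\<close> and disj = \<open>disjoint M\<close>
    and finU = \<open>finite U\<close> and UM = \<open>U \<inter> \<Union>M = {}\<close>
  note edge = Suc.prems(6) and edge_le = Suc.prems(7) and vertex_le = Suc.prems(8)
    and total = Suc.prems(9) and many = Suc.prems(10)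
  have finUM: "finite (\<Union>M)" using finM edge by auto
  obtain i0 where i0: "i0 \<in> S" using Suc.hyps(2) by (metis card.empty ex_in_conv nat.distinct(1))
  have cardS: "card S = Suc k" using Suc.hyps(2) by simp
  \<comment> \<open>Without edges the disjunction leaves at most one vertex, worth at most 1/4,
    against a total of at least 1.\<close>
  have "M \<noteq> {}"
  proof
    assume "M = {}"
    then have "card U \<le> 1" using many cardS by simp
    have "sum (u i0) U \<le> real (card U) * (1/4)"
      by (rule sum_bounded_above) (use vertex_le i0 in auto)
    then show False using total[OF i0] cardS \<open>card U \<le> 1\<close> \<open>M = {}\<close> by simp
  qed
  then obtain e where e: "e \<in> M" by blast
  \<comment> \<open>The bag is \<open>U' \<union> \<Union>M'\<close>. The edge \<open>e\<close>
    makes it bichromatic, and \<open>rest\<close> secures the edge supply for the \<open>k\<close>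
    remaining agents.\<close>
  obtain M' U' i where bag: "M' \<subseteq> M" "U' \<subseteq> U" "e \<in> M'" "i \<in> S"
    and val: "1/4 \<le> sum (u i) (U' \<union> \<Union>M')"
    and small: "\<And>j. j \<in> S \<Longrightarrow> sum (u j) (U' \<union> \<Union>M') \<le> 3/4"
    and rest: "card (U - U') \<le> 1 \<or> k \<le> card (M - M')"
  proof (cases "\<exists>i\<in>S. 1/4 \<le> sum (u i) (U \<union> e)")
    case True
    define P where "P X \<longleftrightarrow> X \<subseteq> U \<and> (\<exists>i\<in>S. 1/4 \<le> sum (u i) (X \<union> e))" for X
    have "P U" using True by (simp add: P_def)
    then obtain X where X: "P X" "\<And>Y. P Y \<Longrightarrow> card X \<le> card Y"
      using ex_has_least_nat[of P U card] by blast
    obtain i where i: "i \<in> S" "1/4 \<le> sum (u i) (X \<union> e)" and XU: "X \<subseteq> U"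
      using X(1) by (auto simp: P_def)
    have finX: "finite X" using XU finU finite_subset by blast
    have small: "sum (u j) (X \<union> e) \<le> 3/4" if j: "j \<in> S" for j
    proof (cases "X = {}")
      case True
      then show ?thesis using edge_le[OF j e] by simp
    next
      case False
      then obtain x where x: "x \<in> X" by blast
      have "\<not> P (X - {x})" using X(2)[of "X - {x}"] x finX
        by (metis card_Diff1_less not_le)
      then have "sum (u j) ((X - {x}) \<union> e) < 1/4" using XU j by (auto simp: P_def not_le)
      moreover have "x \<notin> e" using x XU UM e by blast
      then have "X \<union> e = insert x ((X - {x}) \<union> e)" "x \<notin> (X - {x}) \<union> e" using x by auto
      then have "sum (u j) (X \<union> e) = u j x + sum (u j) ((X - {x}) \<union> e)"
        using finX edge[OF e] by (metis finite_Diff finite_UnI sum.insert)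
      moreover have "u j x \<le> 1/4" using vertex_le j x XU by auto
      ultimately show ?thesis by linarith
    qed
    have "card (U - X) \<le> 1 \<or> k \<le> card (M - {e})"
    proof (cases "card U \<le> 1")
      case True
      then show ?thesis using card_mono[OF finU, of "U - X"] by auto
    next
      case False
      then show ?thesis using many cardS e finM by (simp, linarith)
    qed
    with e i XU small show ?thesis by (intro that[of "{e}" X i]) auto
  next
    case False
    \<comment> \<open>Here \<open>e\<close> with all of \<open>U\<close> is worth less than 1/4 to
      everyone, so a least edge set reaching 1/4 has a further edge \<open>d\<close>. Dropping
      \<open>d\<close> keeps \<open>e\<close>, so minimality gives a value below 1/4;
      \<open>d\<close> adds at most 1/2, whence the bound 3/4.\<close>
    define P where "P N \<longleftrightarrow> N \<subseteq> M \<and> e \<in> N \<and> (\<exists>i\<in>S. 1/4 \<le> sum (u i) (U \<union> \<Union>N))" for N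
    have "P M" using e i0 total[OF i0] cardS by (auto simp: P_def intro!: bexI[of _ i0])
    then obtain N where N: "P N" "\<And>Y. P Y \<Longrightarrow> card N \<le> card Y"
      using ex_has_least_nat[of P M card] by blast
    obtain i where i: "i \<in> S" "1/4 \<le> sum (u i) (U \<union> \<Union>N)" and NM: "N \<subseteq> M" and eN: "e \<in> N"
      using N(1) by (auto simp: P_def)
    have finN: "finite N" using NM finM finite_subset by blast
    have "N \<noteq> {e}" using i False by auto
    then obtain d where d: "d \<in> N" "d \<noteq> e" using eN by blast
    have small: "sum (u j) (U \<union> \<Union>N) \<le> 3/4" if j: "j \<in> S" for j
    proof -
      have "\<not> P (N - {d})" using N(2)[of "N - {d}"] d finN by (metis card_Diff1_less not_le)
      then have "sum (u j) (U \<union> \<Union>(N - {d})) < 1/4"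
        using NM eN d j by (auto simp: P_def not_le)
      moreover have "sum (u j) (U \<union> \<Union>N) = sum (u j) (U \<union> \<Union>(N - {d})) + sum (u j) d"
      proof -
        have "U \<union> \<Union>N = (U \<union> \<Union>(N - {d})) \<union> d" using d by blast
        moreover have "d \<inter> X = {}" if "X \<in> N - {d}" for X
          using disj that d NM by (auto simp: disjoint_def)
        then have "(U \<union> \<Union>(N - {d})) \<inter> d = {}" using UM d NM by blast
        moreover have "finite (\<Union>(N - {d}))" using finN NM edge by auto
        moreover have "finite d" using d NM edge by auto
        ultimately show ?thesis using finU by (simp add: sum.union_disjoint)
      qed
      moreover have "sum (u j) d \<le> 1/2" using edge_le j d NM by auto
      ultimately show ?thesis by linarith
    qed
    show ?thesis using i NM eN small by (intro that[of N U i]) auto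
  qed
  let ?B = "U' \<union> \<Union>M'" and ?V' = "(U - U') \<union> \<Union>(M - M')"
  have dM: "\<Union>M' \<inter> \<Union>(M - M') = {}"
    using disj bag(1) by (fastforce simp: disjoint_def)
  have disjB: "?B \<inter> ?V' = {}" using dM UM bag by blast
  have split: "U \<union> \<Union>M = ?B \<union> ?V'" using bag by blast
  have finB: "finite ?B" "finite ?V'" using finU finUM split by (metis finite_Un)+
  have cardS': "card (S - {i}) = k" using bag cardS finS by simp
  have "\<exists>A. disjoint_family_on A (S - {i}) \<and>
    (\<forall>j\<in>S - {i}. A j \<subseteq> ?V' \<and> bichromatic f (A j) \<and> 1/4 \<le> sum (u j) (A j))"
  proof (rule Suc.hyps(1))
    show "k = card (S - {i})" using cardS' by simp
    show "disjoint (M - M')" using disj by (auto simp: disjoint_def)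
    show "real (card (S - {i})) \<le> sum (u j) ?V'" if "j \<in> S - {i}" for j
    proof -
      have "sum (u j) (U \<union> \<Union>M) = sum (u j) ?B + sum (u j) ?V'"
        unfolding split by (rule sum.union_disjoint[OF finB disjB])
      then show ?thesis using total[of j] small[of j] that cardS cardS' by simp
    qed
    show "card (U - U') \<le> 1 \<or> card (S - {i}) \<le> card (M - M')" using rest cardS' by simp
    show "(U - U') \<inter> \<Union>(M - M') = {}" using UM by blast
  qed (use finS finM finU edge edge_le vertex_le in auto)
  then obtain A where A: "disjoint_family_on A (S - {i})"
    "\<And>j. j \<in> S - {i} \<Longrightarrow> A j \<subseteq> ?V' \<and> bichromatic f (A j) \<and> 1/4 \<le> sum (u j) (A j)" by blast
  have "bichromatic f ?B" using edge[OF e] bag(3) by (blast intro: bichromatic_mono)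
  moreover have "disjoint_family_on (A(i := ?B)) S"
    unfolding disjoint_family_on_def
  proof (intro ballI impI)
    fix j l assume "j \<in> S" "l \<in> S" "j \<noteq> l"
    then show "(A(i := ?B)) j \<inter> (A(i := ?B)) l = {}"
      using A(1) A(2)[of j] A(2)[of l] disjB unfolding disjoint_family_on_def
      by (cases "j = i"; cases "l = i"; simp; blast)
  qed
  ultimately show ?case
    using A(2) val split by (intro exI[of _ "A(i := ?B)"]) auto
qed

section \<open>Maximum matchings between colours\<close>

text \<open>
  A maximum matching that misses two vertices misses only vertices of one colour, and each of its
  edges has an end of that colour, as otherwise it could be enlarged.
\<close>

lemma maximum_matching:
  fixes f :: "'a \<Rightarrow> 'c"
  assumes "finite V"
  obtains M where "disjoint M" "\<And>e. e \<in> M \<Longrightarrow> e \<subseteq> V \<and> card e = 2 \<and> bichromatic f e"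
    and "card (V - \<Union>M) \<le> 1 \<or> (\<exists>c. card {v \<in> V. f v \<noteq> c} \<le> card M)"
proof -
  define P where "P M \<longleftrightarrow> disjoint M \<and> (\<forall>e\<in>M. e \<subseteq> V \<and> card e = 2 \<and> bichromatic f e)" for M
  have PPow: "P M \<Longrightarrow> M \<subseteq> Pow V" for M by (auto simp: P_def)
  then have "card M < Suc (card (Pow V))" if "P M" for M
    using that assms by (simp only: less_Suc_eq_le) (intro card_mono, auto)
  moreover have "P {}" by (simp add: P_def)
  ultimately obtain M where M: "P M" and max: "\<And>N. P N \<Longrightarrow> card N \<le> card M"
    using ex_has_greatest_nat[of P "{}" card "Suc (card (Pow V))"] by metis
  have finM: "finite M" using PPow[OF M] assms by (meson finite_Pow_iff finite_subset)
  have disj: "disjoint M" and edge: "\<And>e. e \<in> M \<Longrightarrow> e \<subseteq> V \<and> card e = 2 \<and> bichromatic f e"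
    using M by (auto simp: P_def)
  have pair: "{x, y} \<subseteq> V \<and> card {x, y} = 2 \<and> bichromatic f {x, y}"
    if "x \<in> V" "y \<in> V" "f x \<noteq> f y" for x y
    using that by (auto simp: bichromatic_def card_insert_if)
  have "\<exists>c. card {v \<in> V. f v \<noteq> c} \<le> card M" if large: "\<not> card (V - \<Union>M) \<le> 1"
  proof -
    obtain a b where ab: "a \<in> V - \<Union>M" "b \<in> V - \<Union>M" "a \<noteq> b"
      using large assms by (metis card_le_Suc0_iff_eq finite_Diff One_nat_def)
    have mono: "f x = f y" if "x \<in> V - \<Union>M" "y \<in> V - \<Union>M" for x y
    proof (rule ccontr)
      assume ne: "f x \<noteq> f y"
      have "P (insert {x, y} M)"
        using M that pair[of x y] ne unfolding P_def disjoint_def by blast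
      moreover have "{x, y} \<notin> M" using that by blast
      ultimately show False using max[of "insert {x, y} M"] finM by simp
    qed
    have touch: "\<exists>x\<in>e. f x = f a" if e: "e \<in> M" for e
    proof (rule ccontr)
      assume none: "\<not> (\<exists>x\<in>e. f x = f a)"
      obtain x y where xy: "e = {x, y}" "x \<noteq> y" using edge[OF e] by (meson card_2_iff)
      have V: "x \<in> V" "y \<in> V" using edge[OF e] xy by auto
      \<comment> \<open>An augmenting path from \<open>a\<close> through \<open>x\<close> and
        \<open>y\<close> to \<open>b\<close>: trading \<open>e\<close> for these two pairs gains an
        edge. Both pairs are bichromatic, since \<open>a\<close> and \<open>b\<close> share a colour
        that neither \<open>x\<close> nor \<open>y\<close> has.\<close>
      let ?N = "insert {a, x} (insert {b, y} (M - {e}))"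
      have fb: "f b = f a" using mono ab by blast
      have notin: "x \<notin> X" "y \<notin> X" "a \<notin> X" "b \<notin> X" if "X \<in> M - {e}" for X
      proof -
        have "X \<in> M" "e \<inter> X = {}" using disj e that by (auto simp: disjoint_def)
        then show "x \<notin> X" "y \<notin> X" "a \<notin> X" "b \<notin> X" using xy ab by auto
      qed
      have "{a, x} \<inter> {b, y} = {}" using ab xy e by auto
      moreover have "disjoint (M - {e})" using disj by (auto simp: disjoint_def)
      ultimately have "disjoint ?N" using notin unfolding pairwise_insert by (auto simp: disjnt_def)
      moreover have "\<forall>d\<in>?N. d \<subseteq> V \<and> card d = 2 \<and> bichromatic f d"
        using edge pair[of a x] pair[of b y] ab V none xy fb by auto
      ultimately have "P ?N" by (simp add: P_def)
      moreover have "{b, y} \<notin> M - {e}" "{a, x} \<notin> insert {b, y} (M - {e})"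
        using notin ab xy e by (auto simp: doubleton_eq_iff)
      then have "card ?N = Suc (card M)" using finM e
        by (metis card.insert card_Suc_Diff1 finite_Diff finite_insert)
      ultimately show False using max[of ?N] by simp
    qed
    \<comment> \<open>By \<open>mono\<close>, vertices of other colours are all matched. An edge has
      only two ends, one of them of the colour of \<open>a\<close>, so it covers at most one vertex
      of \<open>?W\<close>.\<close>
    let ?W = "{v \<in> V. f v \<noteq> f a}"
    have "\<exists>e\<in>M. v \<in> e" if "v \<in> ?W" for v using mono[of v a] ab that by blast
    then obtain g where g: "\<And>v. v \<in> ?W \<Longrightarrow> g v \<in> M \<and> v \<in> g v" by metis
    have "inj_on g ?W"
    proof (rule inj_onI, rule ccontr)
      fix v w assume vw: "v \<in> ?W" "w \<in> ?W" "g v = g w" "v \<noteq> w"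
      obtain x where x: "x \<in> g v" "f x = f a" using touch g vw by blast
      have "{v, w, x} \<subseteq> g v" using x g vw by auto
      moreover have "card (g v) = 2" using g vw edge by blast
      moreover have "x \<noteq> v" "x \<noteq> w" using vw x by auto
      then have "card {v, w, x} = 3" using vw(4) by simp
      ultimately show False
        using card_mono[of "g v" "{v, w, x}"] card.infinite[of "g v"] by fastforce
    qed
    then have "card ?W \<le> card M" using g finM by (intro card_inj_on_le[of g]) auto
    then show ?thesis by blast
  qed
  then show ?thesis using that[of M] disj edge by blast
qed

section \<open>Packing shares of value 1/4\<close>

definition tied :: "('a \<Rightarrow> 'c) \<Rightarrow> 'a set \<Rightarrow> bool" where
  "tied f X \<longleftrightarrow> X = {} \<or> (\<exists>x. X = {x}) \<or> bichromatic f X"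

text \<open>Asking for at least \<open>card S\<close> disjoint sets rather than for a partition
  makes the hypothesis survive the loss of a vertex: an agent who takes a single vertex spoils at
  most one set in the family of any other agent, while the number of agents also falls by one. Once
  every vertex is worth less than 1/4 to everyone, bag filling applies to a maximum
  matching.\<close>

lemma quarter_packing:
  fixes u :: "'i \<Rightarrow> 'a \<Rightarrow> real"
  assumes "finite S" "finite V" "\<And>i x. i \<in> S \<Longrightarrow> x \<in> V \<Longrightarrow> 0 \<le> u i x"
    and "\<And>i. i \<in> S \<Longrightarrow> \<exists>F. disjoint F \<and> card S \<le> card F \<and>
           (\<forall>X\<in>F. X \<subseteq> V \<and> tied f X \<and> 1 \<le> sum (u i) X)"
  shows "\<exists>A. disjoint_family_on A S \<and>
    (\<forall>i\<in>S. A i \<subseteq> V \<and> tied f (A i) \<and> 1/4 \<le> sum (u i) (A i))"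
  using assms
proof (induction "card S" arbitrary: S V)
  case 0
  then show ?case by (auto simp: disjoint_family_on_def)
next
  case (Suc k)
  note finS = \<open>finite S\<close> and finV = \<open>finite V\<close> and nonneg = Suc.prems(3) and share = Suc.prems(4)
  have cardS: "card S = Suc k" using Suc.hyps(2) by simp
  show ?case
  proof (cases "\<exists>i\<in>S. \<exists>x\<in>V. 1/4 \<le> u i x")
    case True
    then obtain i x where i: "i \<in> S" and x: "x \<in> V" and val: "1/4 \<le> u i x" by blast
    have cardS': "card (S - {i}) = k" using i cardS finS by simp
    have "\<exists>A. disjoint_family_on A (S - {i}) \<and>
      (\<forall>j\<in>S - {i}. A j \<subseteq> V - {x} \<and> tied f (A j) \<and> 1/4 \<le> sum (u j) (A j))"
    proof (rule Suc.hyps(1))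
      fix j assume j: "j \<in> S - {i}"
      then obtain F where F: "disjoint F" "card S \<le> card F"
        "\<And>X. X \<in> F \<Longrightarrow> X \<subseteq> V \<and> tied f X \<and> 1 \<le> sum (u j) X" using share[of j] by blast
      have finF: "finite F" using F(2) cardS by (metis card.infinite not_less_eq_eq zero_le)
      \<comment> \<open>By disjointness at most one set of \<open>F\<close> contains
        \<open>x\<close>; the others suffice for the remaining agents.\<close>
      have "is_singleton {X \<in> F. x \<in> X} \<or> {X \<in> F. x \<in> X} = {}"
        using F(1) unfolding is_singleton_def disjoint_def by blast
      then have "card {X \<in> F. x \<in> X} \<le> 1" unfolding is_singleton_altdef
        by (metis card.empty order_refl zero_le)
      moreover have "{X \<in> F. x \<notin> X} = F - {X \<in> F. x \<in> X}" by blast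
      then have "card {X \<in> F. x \<notin> X} = card F - card {X \<in> F. x \<in> X}"
        using finF by (simp add: card_Diff_subset)
      ultimately have "card (S - {i}) \<le> card {X \<in> F. x \<notin> X}" using F(2) cardS cardS' by simp
      moreover have "disjoint {X \<in> F. x \<notin> X}" using F(1) by (auto simp: disjoint_def)
      ultimately show "\<exists>F. disjoint F \<and> card (S - {i}) \<le> card F \<and>
           (\<forall>X\<in>F. X \<subseteq> V - {x} \<and> tied f X \<and> 1 \<le> sum (u j) X)"
        using F(3) by (intro exI[of _ "{X \<in> F. x \<notin> X}"]) auto
    qed (use cardS' finS finV nonneg in auto)
    then obtain A where A: "disjoint_family_on A (S - {i})"
      "\<And>j. j \<in> S - {i} \<Longrightarrow> A j \<subseteq> V - {x} \<and> tied f (A j) \<and> 1/4 \<le> sum (u j) (A j)" by blast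
    have "disjoint_family_on (A(i := {x})) S"
      unfolding disjoint_family_on_def
    proof (intro ballI impI)
      fix j l assume "j \<in> S" "l \<in> S" "j \<noteq> l"
      then show "(A(i := {x})) j \<inter> (A(i := {x})) l = {}"
        using A(1) A(2)[of j] A(2)[of l] unfolding disjoint_family_on_def
        by (cases "j = i"; cases "l = i"; simp; blast)
    qed
    moreover have "\<forall>j\<in>S. (A(i := {x})) j \<subseteq> V \<and> tied f ((A(i := {x})) j) \<and>
        1/4 \<le> sum (u j) ((A(i := {x})) j)"
      using A(2) val x by (auto simp: tied_def)
    ultimately show ?thesis by blast
  next
    case False
    then have small: "\<And>i x. i \<in> S \<Longrightarrow> x \<in> V \<Longrightarrow> u i x < 1/4" by force
    obtain i0 where i0: "i0 \<in> S" using cardS by (metis card.empty ex_in_conv nat.distinct(1))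
    \<comment> \<open>The empty set is worth 0 and a single vertex less than 1/4, so a set worth 1
      can only be tied through two colours.\<close>
    have bichr: "bichromatic f X" if "i \<in> S" "X \<subseteq> V" "tied f X" "1 \<le> sum (u i) X" for i X
      using that small by (fastforce simp: tied_def)
    obtain M where M: "disjoint M" "\<And>e. e \<in> M \<Longrightarrow> e \<subseteq> V \<and> card e = 2 \<and> bichromatic f e"
      and many: "card (V - \<Union>M) \<le> 1 \<or> (\<exists>c. card {v \<in> V. f v \<noteq> c} \<le> card M)"
      using maximum_matching[OF finV] by metis
    have VM: "(V - \<Union>M) \<union> \<Union>M = V" using M(2) by blast
    have finM: "finite M" using M(2) finV by (metis PowI finite_Pow_iff finite_subset subsetI)
    have "\<exists>A. disjoint_family_on A S \<and> (\<forall>i\<in>S. A i \<subseteq> (V - \<Union>M) \<union> \<Union>M \<and>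
        bichromatic f (A i) \<and> 1/4 \<le> sum (u i) (A i))"
    proof (rule bag_filling[OF finS finM M(1)])
      show "(V - \<Union>M) \<inter> \<Union>M = {}" by blast
      show "finite e \<and> bichromatic f e" if "e \<in> M" for e
        using M(2)[OF that] finV finite_subset by blast
      show "sum (u i) e \<le> 1/2" if "i \<in> S" "e \<in> M" for i e
      proof -
        have "sum (u i) e \<le> real (card e) * (1/4)"
          by (rule sum_bounded_above) (use M(2) small that in force)
        then show ?thesis using M(2)[OF that(2)] by simp
      qed
      show "u i x \<le> 1/4" if "i \<in> S" "x \<in> V - \<Union>M" for i x using small[of i x] that by simp
      show "real (card S) \<le> sum (u i) ((V - \<Union>M) \<union> \<Union>M)" if i: "i \<in> S" for i
      proof -
        obtain F where F: "disjoint F" "card S \<le> card F"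
          "\<And>X. X \<in> F \<Longrightarrow> X \<subseteq> V \<and> tied f X \<and> 1 \<le> sum (u i) X" using share[OF i] by blast
        have "\<forall>X\<in>F. finite X" using F(3) finV finite_subset by blast
        then have disj_sum: "sum (u i) (\<Union>F) = (\<Sum>X\<in>F. sum (u i) X)"
          using F(1) by (simp add: sum.Union_disjoint disjoint_def)
        have "real (card F) = (\<Sum>X\<in>F. 1)" by simp
        also have "\<dots> \<le> (\<Sum>X\<in>F. sum (u i) X)" using F(3) by (intro sum_mono) auto
        also have "\<dots> = sum (u i) (\<Union>F)" using disj_sum by simp
        also have "\<dots> \<le> sum (u i) V" using F(3) finV nonneg i by (intro sum_mono2) auto
        finally show ?thesis using F(2) VM by simp
      qed
      show "card (V - \<Union>M) \<le> 1 \<or> card S \<le> card M"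
        using many
      proof
        assume "\<exists>c. card {v \<in> V. f v \<noteq> c} \<le> card M"
        then obtain c where c: "card {v \<in> V. f v \<noteq> c} \<le> card M" ..
        obtain F where F: "disjoint F" "card S \<le> card F"
          "\<And>X. X \<in> F \<Longrightarrow> X \<subseteq> V \<and> tied f X \<and> 1 \<le> sum (u i0) X" using share[OF i0] by blast
        \<comment> \<open>Each set of \<open>F\<close> is bichromatic, hence has a vertex coloured
          differently from \<open>c\<close>. Disjointness makes these vertices distinct, so
          \<open>card S\<close> is at most the number of vertices not coloured \<open>c\<close>,
          which is at most \<open>card M\<close>.\<close>
        have "\<exists>x\<in>X. f x \<noteq> c" if "X \<in> F" for X
          using bichr[OF i0, of X] F(3)[OF that] by (metis bichromatic_obtains)
        then obtain g where g: "\<And>X. X \<in> F \<Longrightarrow> g X \<in> X \<and> f (g X) \<noteq> c" by metis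
        have "inj_on g F" 
          by (rule inj_onI) (metis F(1) g disjointD disjoint_iff)
        moreover have "g ` F \<subseteq> {v \<in> V. f v \<noteq> c}" using g F(3) by blast
        ultimately have "card F \<le> card {v \<in> V. f v \<noteq> c}" using finV by (intro card_inj_on_le) auto
        then show ?thesis using c F(2) by linarith
      qed simp
    qed (use finV in simp)
    then show ?thesis unfolding VM by (auto simp: tied_def)
  qed
qed

section \<open>Covering all vertices, and bundles as tied sets\<close>

text \<open>The whole remainder goes to one set. A bichromatic remainder can join any set. A
  monochromatic one joins a set holding a vertex of another colour; such a vertex exists because
  \<open>V\<close> is bichromatic, and it lies outside the remainder.\<close>

lemma extend_to_cover:
  assumes "finite I" "I \<noteq> {}" "bichromatic f V" "disjoint_family_on A I"
    and "\<And>i. i \<in> I \<Longrightarrow> A i \<subseteq> V \<and> tied f (A i)"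
  shows "\<exists>B. disjoint_family_on B I \<and> (\<Union>i\<in>I. B i) = V \<and>
    (\<forall>i\<in>I. A i \<subseteq> B i \<and> B i \<subseteq> V \<and> tied f (B i))"
proof -
  define L where "L = V - (\<Union>i\<in>I. A i)"
  have "\<exists>i\<in>I. tied f (A i \<union> L)"
  proof (cases "bichromatic f L")
    case True
    then show ?thesis using assms(2) by (auto simp: tied_def intro: bichromatic_mono)
  next
    case False
    show ?thesis
    proof (cases "L = {}")
      case True
      then show ?thesis using assms(2,5) by auto
    next
      case nonempty: False
      then obtain l where l: "l \<in> L" by blast
      obtain v where v: "v \<in> V" "f v \<noteq> f l" using assms(3) by (rule bichromatic_obtains)
      have "v \<notin> L" using False l v unfolding bichromatic_def by metis
      then obtain i where "i \<in> I" "v \<in> A i" using v L_def by blast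
      then show ?thesis using l v by (auto simp: tied_def bichromatic_def intro!: bexI[of _ i])
    qed
  qed
  then obtain i where i: "i \<in> I" "tied f (A i \<union> L)" by blast
  let ?B = "A(i := A i \<union> L)"
  have "disjoint_family_on ?B I"
    using assms(4) i unfolding disjoint_family_on_def L_def by auto
  moreover have "(\<Union>j\<in>I. ?B j) = V" using assms(5) i by (auto simp: L_def)
  moreover have "\<forall>j\<in>I. A j \<subseteq> ?B j \<and> ?B j \<subseteq> V \<and> tied f (?B j)"
    using assms(5) i by (auto simp: L_def)
  ultimately show ?thesis by blast
qed

text \<open>The colour of a vertex is the set of parts containing it, a singleton because
  \<open>Q\<close> is a partition. Two vertices of one part are linked through any vertex of another
  part, while a set inside a single part induces no arcs.\<close>

lemma is_bundle_iff_tied: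
  assumes "complete_multipartite G Q" "X \<subseteq> verts G"
  shows "is_bundle G X \<longleftrightarrow> tied (\<lambda>v. {W \<in> Q. v \<in> W}) X"
proof -
  let ?f = "\<lambda>v. {W \<in> Q. v \<in> W}"
  interpret graph G using assms by (simp add: complete_multipartite_def)
  have part: "partition_on (verts G) Q"
    and adj: "\<And>u v. u \<in> verts G \<Longrightarrow> v \<in> verts G \<Longrightarrow>
      u \<rightarrow>\<^bsub>G\<^esub> v \<longleftrightarrow> \<not> (\<exists>W\<in>Q. u \<in> W \<and> v \<in> W)"
    using assms(1) by (auto simp: complete_multipartite_def)
  have one: "\<exists>W. ?f v = {W}" if "v \<in> verts G" for v
  proof -
    obtain W where W: "W \<in> Q" "v \<in> W" using part \<open>v \<in> verts G\<close> unfolding partition_on_def by blast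
    then have "W' = W" if "W' \<in> Q" "v \<in> W'" for W'
      using part that by (auto simp: partition_on_def disjoint_def)
    then have "?f v = {W}" using W by blast
    then show ?thesis ..
  qed
  have adj_iff: "u \<rightarrow>\<^bsub>G\<^esub> v \<longleftrightarrow> ?f u \<noteq> ?f v" if uv: "u \<in> verts G" "v \<in> verts G" for u v
  proof -
    obtain W W' where W: "?f u = {W}" "?f v = {W'}" using one[OF uv(1)] one[OF uv(2)] by blast
    have "(\<exists>Z\<in>Q. u \<in> Z \<and> v \<in> Z) \<longleftrightarrow> ?f u \<inter> ?f v \<noteq> {}" by blast
    then show ?thesis using adj[OF uv] by (auto simp: W)
  qed
  have sub: "u \<rightarrow>\<^bsub>G \<restriction> X\<^esub> v \<longleftrightarrow> u \<in> X \<and> v \<in> X \<and> ?f u \<noteq> ?f v" for u v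
  proof -
    have "u \<rightarrow>\<^bsub>G \<restriction> X\<^esub> v \<longleftrightarrow> u \<in> X \<and> v \<in> X \<and> u \<rightarrow>\<^bsub>G\<^esub> v"
      by (auto simp: arcs_ends_def arc_to_ends_def)
    then show ?thesis using adj_iff assms(2) by blast
  qed
  interpret H: wf_digraph "G \<restriction> X"
    using induced_induce[OF assms(2)] by (rule wf_digraphI_induced)
  \<comment> \<open>Connectedness is defined through the symmetric closure; as the induced subgraph
    is already symmetric, it amounts to mutual reachability within \<open>X\<close>.\<close>
  have "symmetric (G \<restriction> X)"
    unfolding symmetric_def by (rule symI) (use sub in auto)
  then have conn: "Digraph_Component.connected (G \<restriction> X) \<longleftrightarrow>
      X \<noteq> {} \<and> (\<forall>u\<in>X. \<forall>v\<in>X. u \<rightarrow>\<^sup>*\<^bsub>G \<restriction> X\<^esub> v)"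
    using H.reachable_mk_symmetric_eq
    by (auto simp: connected_def strongly_connected_def mk_symmetric_def)
  show ?thesis
  proof
    assume "is_bundle G X"
    show "tied ?f X"
    proof (rule ccontr)
      assume "\<not> tied ?f X"
      then have X: "X \<noteq> {}" "\<nexists>x. X = {x}" "\<not> bichromatic ?f X" by (auto simp: tied_def)
      then obtain x y where xy: "x \<in> X" "y \<in> X" "x \<noteq> y" by blast
      have "x \<rightarrow>\<^sup>*\<^bsub>G \<restriction> X\<^esub> y" using \<open>is_bundle G X\<close> X xy conn by (auto simp: is_bundle_def)
      \<comment> \<open>A walk between distinct vertices starts with an arc, whose ends differ in
        colour.\<close>
      then obtain z where "x \<rightarrow>\<^bsub>G \<restriction> X\<^esub> z" using xy by (metis H.converse_reachable_cases)
      then show False using sub X(3) unfolding bichromatic_def by blast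
    qed
  next
    assume "tied ?f X"
    then consider "X = {}" | x where "X = {x}" | "bichromatic ?f X" by (auto simp: tied_def)
    then show "is_bundle G X"
    proof cases
      case 1
      then show ?thesis by (simp add: is_bundle_def)
    next
      case 2
      then show ?thesis using conn assms(2) H.reachable_refl[of x] by (simp add: is_bundle_def)
    next
      case 3
      have "u \<rightarrow>\<^sup>*\<^bsub>G \<restriction> X\<^esub> v" if uv: "u \<in> X" "v \<in> X" for u v
      proof (cases "?f u = ?f v")
        case True
        obtain z where "z \<in> X" "?f z \<noteq> ?f u" using 3 by (rule bichromatic_obtains)
        then have "u \<rightarrow>\<^bsub>G \<restriction> X\<^esub> z" "z \<rightarrow>\<^bsub>G \<restriction> X\<^esub> v" using uv True by (simp_all add: sub)
        then show ?thesis by (meson H.reachable_adjI H.reachable_trans)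
      next
        case False
        then show ?thesis using sub uv by (intro H.reachable_adjI) blast
      qed
      moreover have "X \<noteq> {}" using 3 by (auto simp: bichromatic_def)
      ultimately show ?thesis using conn assms(2) by (simp add: is_bundle_def)
    qed
  qed
qed

section \<open>The allocation for complete multipartite graphs\<close>

theorem theorem3:
  fixes G :: "('a, 'b) pre_digraph" and Q :: "'a set set"
    and n :: nat and u :: "nat \<Rightarrow> 'a \<Rightarrow> real"
  assumes "complete_multipartite G Q"
    and "card Q \<ge> 2"
    and "n \<ge> 1"
    and "\<And>i v. i \<in> {1..n} \<Longrightarrow> v \<in> verts G \<Longrightarrow> u i v \<ge> 0"
  shows "\<exists>A. mms_allocation (1/4) G n u A"
proof -
  let ?f = "\<lambda>v. {W \<in> Q. v \<in> W}"
  interpret graph G using assms by (simp add: complete_multipartite_def)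
  note conn = complete_multipartite_connected[OF assms(1,2)]
  have part: "partition_on (verts G) Q" using assms(1) by (simp add: complete_multipartite_def)
  have bi: "bichromatic ?f (verts G)"
  proof -
    obtain W W' where W: "W \<in> Q" "W' \<in> Q" "W \<noteq> W'"
      using assms(2) by (metis card_le_Suc0_iff_eq card.infinite not_numeral_le_zero
          One_nat_def Suc_1 not_less_eq_eq)
    obtain x y where "x \<in> W" "y \<in> W'" using part W by (metis partition_on_def ex_in_conv)
    moreover have "y \<notin> W" "x \<in> verts G" "y \<in> verts G"
      using part W calculation by (auto simp: partition_on_def disjoint_def)
    ultimately show ?thesis using W unfolding bichromatic_def by blast
  qed
  \<comment> \<open>The maximum is over finitely many values, and there is at least one because
    \<open>G\<close> is connected and \<open>n\<close> is positive; hence some partition attains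
    it.\<close>
  have attained: "\<exists>P. graph_partition G n P \<and> (\<forall>j\<in>{1..n}. mms n G w \<le> utility w (P j))" for w
  proof -
    have "mms n G w \<in> {Min ((\<lambda>j. utility w (P j)) ` {1..n}) | P. graph_partition G n P}"
      unfolding mms_def
      using graph_partition_exists[OF wf_digraph_axioms conn assms(3)]
      by (intro Max_in finite_mms_values assms(3) finite_verts) blast
    then show ?thesis by (auto intro: Min_le)
  qed
  \<comment> \<open>Normalising divides by the share, so it is confined to agents with a positive
    share. The others accept any bundle, its utility being nonnegative.\<close>
  define S where "S = {i \<in> {1..n}. 0 < mms n G (u i)}"
  define w where "w i v = u i v / mms n G (u i)" for i v
  have scale: "sum (w i) X = sum (u i) X / mms n G (u i)" for i X
    unfolding w_def by (simp add: sum_divide_distrib)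
  have "\<exists>A. disjoint_family_on A S \<and>
    (\<forall>i\<in>S. A i \<subseteq> verts G \<and> tied ?f (A i) \<and> 1/4 \<le> sum (w i) (A i))"
  proof (rule quarter_packing)
    show "0 \<le> w i x" if "i \<in> S" "x \<in> verts G" for i x
      using assms(4) that by (auto simp: S_def w_def)
    fix i assume i: "i \<in> S"
    obtain P where P: "graph_partition G n P" "\<And>j. j \<in> {1..n} \<Longrightarrow> mms n G (u i) \<le> utility (u i) (P j)"
      using attained by blast
    \<comment> \<open>A set of positive utility is nonempty, so the disjoint sets \<open>P j\<close>
      are pairwise distinct and form a family of \<open>n\<close> members, at least
      \<open>card S\<close>.\<close>
    have ne: "P j \<noteq> {}" if "j \<in> {1..n}" for j
      using P(2)[OF that] i by (auto simp: S_def utility_def)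
    have disj: "P j \<inter> P l = {}" if "j \<in> {1..n}" "l \<in> {1..n}" "j \<noteq> l" for j l
      using P(1) that by (auto simp: graph_partition_def disjoint_family_on_def)
    have "inj_on P {1..n}"
      by (rule inj_onI) (metis disj ne inf.idem)
    then have "card (P ` {1..n}) = n" by (simp add: card_image)
    moreover have "card S \<le> n" using card_mono[of "{1..n}" S] unfolding S_def by fastforce
    moreover have "disjoint (P ` {1..n})" using disj by (fastforce simp: disjoint_def)
    moreover have "X \<subseteq> verts G \<and> tied ?f X \<and> 1 \<le> sum (w i) X" if X: "X \<in> P ` {1..n}" for X
    proof -
      have "is_bundle G X" "mms n G (u i) \<le> utility (u i) X"
        using P X by (auto simp: graph_partition_def)
      moreover have "X \<subseteq> verts G" using calculation by (simp add: is_bundle_def)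
      ultimately show ?thesis
        using is_bundle_iff_tied[OF assms(1)] i by (simp add: scale utility_def S_def)
    qed
    ultimately show "\<exists>F. disjoint F \<and> card S \<le> card F \<and>
        (\<forall>X\<in>F. X \<subseteq> verts G \<and> tied ?f X \<and> 1 \<le> sum (w i) X)"
      by (intro exI[of _ "P ` {1..n}"]) simp
  qed (auto simp: S_def)
  then obtain A where A: "disjoint_family_on A S"
    "\<And>i. i \<in> S \<Longrightarrow> A i \<subseteq> verts G \<and> tied ?f (A i) \<and> 1/4 \<le> sum (w i) (A i)" by blast
  \<comment> \<open>Agents outside \<open>S\<close> start with the empty bundle; one agent then
    receives the leftovers, which lowers no utility.\<close>
  define A' where "A' i = (if i \<in> S then A i else {})" for i
  have "\<exists>B. disjoint_family_on B {1..n} \<and> (\<Union>i\<in>{1..n}. B i) = verts G \<and>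
    (\<forall>i\<in>{1..n}. A' i \<subseteq> B i \<and> B i \<subseteq> verts G \<and> tied ?f (B i))"
  proof (rule extend_to_cover)
    show "disjoint_family_on A' {1..n}"
      using A(1) by (auto simp: A'_def disjoint_family_on_def)
    show "A' i \<subseteq> verts G \<and> tied ?f (A' i)" for i
      using A(2)[of i] by (simp add: A'_def tied_def)
  qed (use assms(3) bi in auto)
  then obtain B where B: "disjoint_family_on B {1..n}" "(\<Union>i\<in>{1..n}. B i) = verts G"
    "\<And>i. i \<in> {1..n} \<Longrightarrow> A' i \<subseteq> B i \<and> B i \<subseteq> verts G \<and> tied ?f (B i)"
    by (elim exE conjE) (rule that, auto)
  have "graph_partition G n B"
    using B is_bundle_iff_tied[OF assms(1)] by (auto simp: graph_partition_def)
  moreover have "1/4 * mms n G (u i) \<le> utility (u i) (B i)" if i: "i \<in> {1..n}" for i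
  proof (cases "i \<in> S")
    case True
    have "1/4 * mms n G (u i) \<le> sum (u i) (A i)"
      using A(2)[OF True] True by (simp add: scale S_def field_simps)
    also have "\<dots> \<le> sum (u i) (B i)"
      using B(3)[OF i] True assms(4)[OF i] finite_subset[OF _ finite_verts]
      by (intro sum_mono2) (auto simp: A'_def)
    finally show ?thesis by (simp add: utility_def)
  next
    case False
    then have "mms n G (u i) \<le> 0" using i by (simp add: S_def)
    moreover have "0 \<le> utility (u i) (B i)"
      using B(3)[OF i] assms(4)[OF i] by (auto simp: utility_def intro: sum_nonneg)
    ultimately show ?thesis by linarith
  qed
  ultimately show ?thesis unfolding mms_allocation_def by blast
qed

end
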